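(* There exists $C>0$, only depending on $n$, such that the following statement holds. Let $\lambda\ge1$ and $R,r>0$ with $\lambda R\ge r>0$, and let $u\in L^1_{\rm loc}(B_{R+r})$ with $u\in L^\infty(B_r)\cap L^1(B_R)$. Let $$\langle u\rangle_R:=\frac{1}{\mathcal{L}^n(B_R)}\int_{B_R}u.$$ Then $$\int_{B_R}\big|u-\langle u\rangle_R\big|\le\frac{CR\lambda}{r}\int_{B_R}\operatorname*{osc}_{B_r(x)}u\,dx.$$
   Context: $B_\rho(x)$ is the ball of radius $\rho$ centered at $x$ in $\mathbb{R}^n$, $B_\rho:=B_\rho(0)$, and $\mathcal{L}^n$ is the $n$-dimensional Lebesgue measure. The oscillation is $\operatorname*{osc}_{B_r(x)}u:=\sup_{B_r(x)}u-\inf_{B_r(x)}u$, where $\sup$ and $\inf$ denote the essential supremum and infimum. *)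

theory Defs
  imports "HOL-Analysis.Analysis" "HOL-Probability.Essential_Supremum"
begin

text \<open>
  Functions on a subset of \<open>\<real>\<^sup>n\<close> are represented by total functions whose values
  outside the subset are irrelevant; every notion below only looks at the values of
  the function on the given set. Measurability and integrability are with respect to the
  (complete) Lebesgue measure.
\<close>

definition L1_on :: "'a::euclidean_space set \<Rightarrow> ('a \<Rightarrow> real) \<Rightarrow> bool"
  where "L1_on S u \<longleftrightarrow> integrable (lebesgue_on S) u"

definition L1_loc_on :: "'a::euclidean_space set \<Rightarrow> ('a \<Rightarrow> real) \<Rightarrow> bool"
  where "L1_loc_on S u \<longleftrightarrow> (\<forall>K. compact K \<and> K \<subseteq> S \<longrightarrow> L1_on K u)"

definition Linf_on :: "'a::euclidean_space set \<Rightarrow> ('a \<Rightarrow> real) \<Rightarrow> bool"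
  where "Linf_on S u \<longleftrightarrow>
    u \<in> borel_measurable (lebesgue_on S) \<and> esssup (lebesgue_on S) (\<lambda>x. ereal \<bar>u x\<bar>) < \<infinity>"

text \<open>The dual of \<^const>\<open>esssup\<close>, with the dual convention for non-measurable functions.\<close>

definition essinf :: "'a measure \<Rightarrow> ('a \<Rightarrow> ereal) \<Rightarrow> ereal"
  where "essinf M f = (if f \<in> borel_measurable M then Liminf (ae_filter M) f else bot)"

lemma essinf_eq_AE:
  assumes f: "f \<in> borel_measurable M"
  shows "essinf M f = Sup {z. AE x in M. z \<le> f x}"
  unfolding essinf_def if_P[OF f] Liminf_def
proof (intro antisym SUP_least Sup_least; clarsimp)
  fix y assume "AE x in M. y \<le> f x"
  then have "(\<lambda>x. y \<le> f x) \<in> {P. AE x in M. P x}"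
    by simp
  then show "y \<le> (SUP P\<in>{P. AE x in M. P x}. INF x\<in>Collect P. f x)"
    by (rule SUP_upper2) (auto intro: INF_greatest)
next
  fix P assume P: "AE x in M. P x"
  show "(INF x\<in>Collect P. f x) \<le> Sup {z. AE x in M. z \<le> f x}"
  proof (rule Sup_upper; clarsimp)
    show "AE x in M. (INF x\<in>Collect P. f x) \<le> f x"
      using P by (auto elim: eventually_mono simp: INF_lower)
  qed
qed

text \<open>
  The essential oscillation is extended-real valued: it may be \<open>\<infinity>\<close> on balls where
  the function is essentially unbounded.
\<close>

definition osc_on :: "'a::euclidean_space set \<Rightarrow> ('a \<Rightarrow> real) \<Rightarrow> ereal"
  where "osc_on S u =
    esssup (lebesgue_on S) (\<lambda>y. ereal (u y)) - essinf (lebesgue_on S) (\<lambda>y. ereal (u y))"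

definition average_on :: "'a::euclidean_space set \<Rightarrow> ('a \<Rightarrow> real) \<Rightarrow> real"
  where "average_on S u = (1 / measure lebesgue S) * (LINT x|lebesgue_on S. u x)"

end

theory Submission
  imports Defs
begin

text \<open>
  The inequality is a Poincare inequality in which the oscillation at scale \<open>r\<close>, divided by \<open>r\<close>,
  plays the role of the gradient; the proof is the classical one by integration along segments,
  in a discrete form. Write \<open>B\<close> for the ball of radius \<open>R\<close>, \<open>n\<close> for the dimension, and
  \<open>g x\<close> for the oscillation of \<open>u\<close> on the ball of radius \<open>r\<close> around \<open>x\<close>. The deviation of \<open>u x\<close>
  from the average is at most the average of \<open>\<bar>u x - u y\<bar>\<close> over \<open>y \<in> B\<close>. Split the segment from
  \<open>x\<close> to \<open>y\<close> at the points \<open>x\<^sub>k = (1 - k/N) x + (k/N) y\<close>, where \<open>N \<ge> 2 R / r\<close> makes consecutive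
  points closer than \<open>r\<close>. Telescoping gives \<open>\<bar>u x - u y\<bar> \<le> (\<Sum>k<N. g x\<^sub>k)\<close>, and each
  term satisfies \<open>\<integral>\<integral> g x\<^sub>k dx dy \<le> 2^n |B| \<integral> g\<close>: of the two weights \<open>1 - k/N\<close>
  and \<open>k/N\<close> one is at least \<open>1/2\<close>, so the integration in the corresponding variable can be done
  first, at the price of a Jacobian factor at most \<open>2^n\<close>
  (\<open>nn_integral_segment_point_le\<close>). Summing over \<open>k\<close>, the total is
  \<open>N 2^n \<integral> g\<close>. The choice \<open>N = \<lceil>2 R / r\<rceil>\<close> together with \<open>\<lambda> \<ge> 1\<close> and
  \<open>r \<le> \<lambda> R\<close> gives \<open>N \<le> 2 R / r + 1 \<le> 3 R \<lambda> / r\<close>, hence \<open>C = 3 \<cdot> 2^n\<close>.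

  Two measure-theoretic points need care, because \<open>g\<close> is an essential oscillation. The telescoping
  evaluates \<open>u\<close> at individual points, so one needs a single null set off which
  \<open>\<bar>u a - u b\<bar>\<close> is bounded by the oscillation on every open set containing \<open>a\<close> and \<open>b\<close>
  (\<open>AE_abs_diff_le_osc_on\<close>, by a countable basis). And the exchange of the order of integration
  needs \<open>g\<close> to be Borel (\<open>borel_measurable_osc_ball\<close>): essential suprema over moving balls are
  lower semicontinuous in the centre.
\<close>

section \<open>Essential bounds on open sets and values at almost every point\<close>

lemma essinf_eq_uminus_esssup:
  fixes f :: "'a \<Rightarrow> ereal"
  shows "essinf M f = - esssup M (\<lambda>x. - f x)"
  by (simp add: essinf_def esssup_def ereal_Limsup_uminus bot_ereal_def top_ereal_def)

lemma esssup_le_iff: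
  assumes "f \<in> borel_measurable M"
  shows "esssup M f \<le> c \<longleftrightarrow> (AE x in M. f x \<le> c)"
  using esssup_I[OF assms] esssup_AE[of f M] by (auto elim: eventually_mono intro: order_trans)

lemma AE_lebesgue_on_iff:
  assumes "open S"
  shows "(AE y in lebesgue_on S. P y) \<longleftrightarrow> (AE y in lebesgue. y \<in> S \<longrightarrow> P y)"
  using assms by (intro AE_restrict_space_iff) auto

text \<open>
  The point of the statement is that the exceptional set of \<open>b\<close> does not depend on \<open>S\<close>. For one
  fixed \<open>S\<close> the claim is trivial; it then holds simultaneously for all members of a countable basis,
  and any open neighbourhood contains a basic one.
\<close>

lemma AE_holds_of_AE_open_nbhd:
  fixes P :: "'a::euclidean_space \<Rightarrow> bool"
  shows "AE b in lebesgue. \<forall>S. open S \<longrightarrow> b \<in> S \<longrightarrow> (AE y in lebesgue. y \<in> S \<longrightarrow> P y) \<longrightarrow> P b"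
proof -
  obtain B :: "'a set set" where B: "countable B" "topological_basis B"
    using ex_countable_basis by blast
  have "AE b in lebesgue. \<forall>U\<in>B. (AE y in lebesgue. y \<in> U \<longrightarrow> P y) \<longrightarrow> b \<in> U \<longrightarrow> P b"
    by (intro AE_ball_countable' B) (auto simp: AE_all_countable)
  then show ?thesis
  proof (rule eventually_mono, intro allI impI)
    fix b S
    assume b: "\<forall>U\<in>B. (AE y in lebesgue. y \<in> U \<longrightarrow> P y) \<longrightarrow> b \<in> U \<longrightarrow> P b"
      and S: "open S" "b \<in> S" "AE y in lebesgue. y \<in> S \<longrightarrow> P y"
    obtain U where U: "U \<in> B" "b \<in> U" "U \<subseteq> S"
      using topological_basisE[OF B(2) S(1,2)] by blast
    have "AE y in lebesgue. y \<in> U \<longrightarrow> P y"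
      using S(3) by (rule eventually_mono) (use U in auto)
    then show "P b" using b U by blast
  qed
qed

text \<open>
  If \<open>u b\<close> exceeded the essential supremum on \<open>S\<close>, a rational \<open>q\<close> would lie in between, and
  \<open>u \<le> q\<close> almost everywhere on \<open>S\<close> but not at \<open>b\<close>. There are countably many such \<open>q\<close>. When \<open>u\<close> is not
  measurable on \<open>S\<close> the essential supremum is \<open>\<infinity>\<close> by convention.
\<close>

lemma AE_le_esssup_open_nbhd:
  fixes u :: "'a::euclidean_space \<Rightarrow> real"
  shows "AE b in lebesgue. \<forall>S. open S \<longrightarrow> b \<in> S \<longrightarrow>
    ereal (u b) \<le> esssup (lebesgue_on S) (\<lambda>y. ereal (u y))"
proof -
  have "AE b in lebesgue. \<forall>q::rat. \<forall>S. open S \<longrightarrow> b \<in> S \<longrightarrow>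
      (AE y in lebesgue. y \<in> S \<longrightarrow> u y \<le> of_rat q) \<longrightarrow> u b \<le> of_rat q"
    by (subst AE_all_countable) (intro allI AE_holds_of_AE_open_nbhd)
  then show ?thesis
  proof (rule eventually_mono, goal_cases)
    case (1 b)
    show ?case
    proof (intro allI impI, rule ccontr)
      fix S
      assume S: "open S" "b \<in> S"
        and "\<not> ereal (u b) \<le> esssup (lebesgue_on S) (\<lambda>y. ereal (u y))"
      then obtain q :: rat where q: "esssup (lebesgue_on S) (\<lambda>y. ereal (u y)) < real_of_rat q"
          "real_of_rat q < ereal (u b)"
        using ereal_dense3 not_le by metis
      have "AE y in lebesgue_on S. u y \<le> of_rat q"
        using esssup_AE[of "\<lambda>y. ereal (u y)" "lebesgue_on S"]
        by (rule eventually_mono) (use q(1) in \<open>metis ereal_less_eq(3) less_imp_le order_trans\<close>)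
      then have "u b \<le> of_rat q"
        using S by (intro 1[rule_format, of S]) (simp_all add: AE_lebesgue_on_iff)
      with q(2) show False by simp
    qed
  qed
qed

text \<open>
  A set \<open>G\<close> of full measure on which the pointwise values of \<open>u\<close> may be used: as \<open>G\<close> serves all
  open sets \<open>S\<close> at once, \<open>S\<close> can later be a ball whose centre is one of the two points.
\<close>

lemma AE_abs_diff_le_osc_on:
  fixes u :: "'a::euclidean_space \<Rightarrow> real"
  obtains G where "AE x in lebesgue. x \<in> G"
    and "\<And>a b S. a \<in> G \<Longrightarrow> b \<in> G \<Longrightarrow> open S \<Longrightarrow> a \<in> S \<Longrightarrow> b \<in> S \<Longrightarrow>
      ennreal \<bar>u a - u b\<bar> \<le> e2ennreal (osc_on S u)"
proof
  let ?M = "\<lambda>v S. esssup (lebesgue_on S) (\<lambda>y. ereal (v y))"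
  let ?G = "{x. (\<forall>S. open S \<longrightarrow> x \<in> S \<longrightarrow> ereal (u x) \<le> ?M u S) \<and>
    (\<forall>S. open S \<longrightarrow> x \<in> S \<longrightarrow> ereal (- u x) \<le> ?M (\<lambda>y. - u y) S)}"
  show "AE x in lebesgue. x \<in> ?G"
    unfolding mem_Collect_eq
    by (intro AE_conjI AE_le_esssup_open_nbhd)
  fix a b S assume *: "a \<in> ?G" "b \<in> ?G" "open S" "a \<in> S" "b \<in> S"
  have le: "ereal (u x - u y) \<le> osc_on S u" if "x \<in> {a,b}" "y \<in> {a,b}" for x y
  proof -
    have "ereal (u x) \<le> ?M u S" "ereal (- u y) \<le> ?M (\<lambda>y. - u y) S"
      using * that by blast+
    then have "ereal (u x) - ereal (u y) \<le> osc_on S u"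
      unfolding osc_on_def essinf_eq_uminus_esssup
      by (intro ereal_minus_mono) (auto simp: ereal_uminus_le_reorder)
    then show ?thesis by simp
  qed
  have "ereal \<bar>u a - u b\<bar> \<le> osc_on S u"
    using le[of a b] le[of b a] by (auto simp: abs_if)
  then show "ennreal \<bar>u a - u b\<bar> \<le> e2ennreal (osc_on S u)"
    by (metis e2ennreal_mono e2ennreal_ereal)
qed

section \<open>Borel measurability of the oscillation on moving balls\<close>

text \<open>
  If \<open>P\<close> fails on a non-null part of an open ball, then, the ball being the union of the concentric
  balls of radius \<open>r - 1/(n+1)\<close>, it already fails on a non-null part of one of these; and the
  latter is contained in every ball of radius \<open>r\<close> whose centre is moved by less than
  \<open>1/(n+1)\<close>.
\<close>

lemma open_not_AE_on_ball:
  fixes P :: "'a::euclidean_space \<Rightarrow> bool"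
  shows "open {x. \<not> (AE y in lebesgue. y \<in> ball x r \<longrightarrow> P y)}"
  unfolding open_dist
proof safe
  fix x assume nae: "\<not> (AE y in lebesgue. y \<in> ball x r \<longrightarrow> P y)"
  have "\<not> (\<forall>n::nat. AE y in lebesgue. y \<in> ball x (r - 1 / Suc n) \<longrightarrow> P y)"
  proof
    assume "\<forall>n::nat. AE y in lebesgue. y \<in> ball x (r - 1 / Suc n) \<longrightarrow> P y"
    then have "AE y in lebesgue. \<forall>n::nat. y \<in> ball x (r - 1 / Suc n) \<longrightarrow> P y"
      by (subst AE_all_countable)
    then have "AE y in lebesgue. y \<in> ball x r \<longrightarrow> P y"
    proof (rule eventually_mono, intro impI)
      fix y assume y: "\<forall>n::nat. y \<in> ball x (r - 1 / Suc n) \<longrightarrow> P y" "y \<in> ball x r"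
      obtain n where "1 / real (Suc n) < r - dist x y"
        using nat_approx_posE[of "r - dist x y"] y(2) by auto
      then show "P y" using y(1) by (auto dest!: spec[of _ n])
    qed
    with nae show False ..
  qed
  then obtain n :: nat where n: "\<not> (AE y in lebesgue. y \<in> ball x (r - 1 / Suc n) \<longrightarrow> P y)"
    by blast
  show "\<exists>e>0. \<forall>x'. dist x' x < e \<longrightarrow> x' \<in> {x. \<not> (AE y in lebesgue. y \<in> ball x r \<longrightarrow> P y)}"
  proof (intro exI[of _ "1 / real (Suc n)"] conjI allI impI CollectI notI)
    fix x' assume d: "dist x' x < 1 / real (Suc n)"
      and "AE y in lebesgue. y \<in> ball x' r \<longrightarrow> P y"
    then have "AE y in lebesgue. y \<in> ball x (r - 1 / Suc n) \<longrightarrow> P y"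
    proof (elim eventually_mono, intro impI)
      fix y assume P: "y \<in> ball x' r \<longrightarrow> P y" and y: "y \<in> ball x (r - 1 / Suc n)"
      have "dist x' y < r" using dist_triangle[of x' y x] d y by auto
      then show "P y" using P by simp
    qed
    with n show False ..
  qed auto
qed

text \<open>
  The sublevel sets are relatively closed by \<open>open_not_AE_on_ball\<close>, i.e. the function is lower
  semicontinuous.
\<close>

lemma borel_measurable_esssup_ball:
  fixes v :: "'a::euclidean_space \<Rightarrow> real"
  assumes "A \<in> sets borel" and v: "\<And>x. x \<in> A \<Longrightarrow> v \<in> borel_measurable (lebesgue_on (ball x r))"
  shows "(\<lambda>x. esssup (lebesgue_on (ball x r)) (\<lambda>y. ereal (v y)))
    \<in> borel_measurable (restrict_space borel A)"
proof (rule borel_measurableI_le)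
  fix c :: ereal
  have "esssup (lebesgue_on (ball x r)) (\<lambda>y. ereal (v y)) \<le> c \<longleftrightarrow>
      (AE y in lebesgue. y \<in> ball x r \<longrightarrow> ereal (v y) \<le> c)" if "x \<in> A" for x
    using v[OF that] by (subst esssup_le_iff) (auto simp: AE_lebesgue_on_iff)
  then have "{x \<in> space (restrict_space borel A).
      esssup (lebesgue_on (ball x r)) (\<lambda>y. ereal (v y)) \<le> c} =
      A - {x. \<not> (AE y in lebesgue. y \<in> ball x r \<longrightarrow> ereal (v y) \<le> c)}"
    by (auto simp: space_restrict_space)
  moreover have "\<dots> \<in> sets borel"
    by (intro sets.Diff assms(1) borel_open open_not_AE_on_ball)
  ultimately show "{x \<in> space (restrict_space borel A).
      esssup (lebesgue_on (ball x r)) (\<lambda>y. ereal (v y)) \<le> c} \<in> sets (restrict_space borel A)"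
    using assms(1) by (simp add: sets_restrict_space_iff)
qed

lemma borel_measurable_osc_ball:
  fixes u :: "'a::euclidean_space \<Rightarrow> real"
  assumes "A \<in> sets borel" and u: "\<And>x. x \<in> A \<Longrightarrow> u \<in> borel_measurable (lebesgue_on (ball x r))"
  shows "(\<lambda>x. e2ennreal (osc_on (ball x r) u) * indicator A x) \<in> borel_measurable borel"
proof -
  have "(\<lambda>x. osc_on (ball x r) u) \<in> borel_measurable (restrict_space borel A)"
    unfolding osc_on_def essinf_eq_uminus_esssup uminus_ereal.simps
    by (intro borel_measurable_ereal_diff borel_measurable_uminus_ereal
        borel_measurable_esssup_ball borel_measurable_uminus assms)
  then have "(\<lambda>x. e2ennreal (osc_on (ball x r) u)) \<in> borel_measurable (restrict_space borel A)"
    by simp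
  then show ?thesis
    using assms(1) by (subst (asm) borel_measurable_restrict_space_iff_ennreal) auto
qed

section \<open>Averaging over points of segments\<close>

lemma nn_integral_lborel_affine:
  fixes g :: "'a::euclidean_space \<Rightarrow> ennreal"
  assumes c: "c \<noteq> 0" and [measurable]: "g \<in> borel_measurable borel"
  shows "(\<integral>\<^sup>+x. g x \<partial>lborel) = ennreal (\<bar>c\<bar> ^ DIM('a)) * (\<integral>\<^sup>+x. g (t + c *\<^sub>R x) \<partial>lborel)"
  by (subst lborel_affine[OF c, of t])
     (simp add: nn_integral_density nn_integral_distr nn_integral_cmult)

lemma AE_lborel_affine:
  fixes P :: "'a::euclidean_space \<Rightarrow> bool"
  assumes "AE x in lborel. P x" and c: "c \<noteq> 0"
  shows "AE x in lborel. P (t + c *\<^sub>R x)"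
proof -
  have "AE x in density (distr lborel borel (\<lambda>x. t + c *\<^sub>R x)) (\<lambda>_. ennreal (\<bar>c\<bar> ^ DIM('a))). P x"
    using assms(1) unfolding lborel_affine[OF c, of t, symmetric] .
  then have "AE x in distr lborel borel (\<lambda>x. t + c *\<^sub>R x). P x"
    using c by (subst (asm) AE_density) (auto simp: ennreal_zero_less_mult_iff)
  then show ?thesis
    by (rule AE_distrD[rotated]) simp
qed

text \<open>
  For \<open>t \<ge> 1/2\<close> and fixed \<open>x\<close>, the substitution \<open>z = (1 - t) x + t y\<close> bounds the inner integral by
  \<open>t^-n \<integral> g \<le> 2^n \<integral> g\<close>, uniformly in \<open>x\<close>. For \<open>t < 1/2\<close> the order of integration is
  exchanged, so that the roles of \<open>x\<close> and \<open>y\<close>, and of \<open>t\<close> and \<open>1 - t\<close>, are swapped. Fixing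
  always the same variable would leave a factor that is unbounded near one of the endpoints.
\<close>

lemma nn_integral_segment_point_le:
  fixes g :: "'a::euclidean_space \<Rightarrow> ennreal"
  assumes [measurable]: "g \<in> borel_measurable borel" "B \<in> sets borel"
  shows "(\<integral>\<^sup>+x. (\<integral>\<^sup>+y. g ((1 - t) *\<^sub>R x + t *\<^sub>R y) * indicator B y \<partial>lborel) * indicator B x \<partial>lborel)
    \<le> 2 ^ DIM('a) * emeasure lborel B * (\<integral>\<^sup>+x. g x \<partial>lborel)"
proof -
  have scale: "(\<integral>\<^sup>+y. g (a + s *\<^sub>R y) \<partial>lborel) \<le> 2 ^ DIM('a) * (\<integral>\<^sup>+y. g y \<partial>lborel)"
    if s: "1/2 \<le> s" for a s
  proof -
    have "1 \<le> 2 ^ DIM('a) * \<bar>s\<bar> ^ DIM('a)"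
      using s one_le_power[of "2 * \<bar>s\<bar>" "DIM('a)"] by (simp add: power_mult_distrib)
    then have "1 \<le> ennreal (2 ^ DIM('a) * \<bar>s\<bar> ^ DIM('a))"
      by simp
    then have "1 * (\<integral>\<^sup>+y. g (a + s *\<^sub>R y) \<partial>lborel) \<le>
        ennreal (2 ^ DIM('a) * \<bar>s\<bar> ^ DIM('a)) * (\<integral>\<^sup>+y. g (a + s *\<^sub>R y) \<partial>lborel)"
      by (rule mult_right_mono) simp
    also have "\<dots> = 2 ^ DIM('a) * (ennreal (\<bar>s\<bar> ^ DIM('a)) * (\<integral>\<^sup>+y. g (a + s *\<^sub>R y) \<partial>lborel))"
      by (simp add: ennreal_mult mult.assoc flip: ennreal_power)
    also have "\<dots> = 2 ^ DIM('a) * (\<integral>\<^sup>+y. g y \<partial>lborel)"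
      using s by (subst nn_integral_lborel_affine[of s g a]) auto
    finally show ?thesis by simp
  qed
  have main: "(\<integral>\<^sup>+x. (\<integral>\<^sup>+y. g ((1 - s) *\<^sub>R x + s *\<^sub>R y) * indicator B y \<partial>lborel) * indicator B x \<partial>lborel)
    \<le> 2 ^ DIM('a) * emeasure lborel B * (\<integral>\<^sup>+x. g x \<partial>lborel)" if s: "1/2 \<le> s" for s
  proof -
    have "(\<integral>\<^sup>+y. g ((1 - s) *\<^sub>R x + s *\<^sub>R y) * indicator B y \<partial>lborel) \<le>
        2 ^ DIM('a) * (\<integral>\<^sup>+y. g y \<partial>lborel)" for x
      by (rule order_trans[OF nn_integral_mono scale[OF s]]) (auto simp: indicator_def)
    then have "(\<integral>\<^sup>+x. (\<integral>\<^sup>+y. g ((1 - s) *\<^sub>R x + s *\<^sub>R y) * indicator B y \<partial>lborel) * indicator B x \<partial>lborel)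
        \<le> (\<integral>\<^sup>+x. 2 ^ DIM('a) * (\<integral>\<^sup>+y. g y \<partial>lborel) * indicator B x \<partial>lborel)"
      by (intro nn_integral_mono mult_right_mono) auto
    also have "\<dots> = 2 ^ DIM('a) * emeasure lborel B * (\<integral>\<^sup>+x. g x \<partial>lborel)"
      by (subst nn_integral_cmult_indicator) (simp_all add: mult_ac)
    finally show ?thesis .
  qed
  show ?thesis
  proof (cases "1/2 \<le> t")
    case True
    then show ?thesis by (rule main)
  next
    case False
    have "(\<integral>\<^sup>+x. (\<integral>\<^sup>+y. g ((1 - t) *\<^sub>R x + t *\<^sub>R y) * indicator B y \<partial>lborel) * indicator B x \<partial>lborel)
        = (\<integral>\<^sup>+x. (\<integral>\<^sup>+y. g ((1 - t) *\<^sub>R x + t *\<^sub>R y) * indicator B y * indicator B x \<partial>lborel) \<partial>lborel)"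
      by (simp add: nn_integral_multc)
    also have "\<dots> = (\<integral>\<^sup>+y. (\<integral>\<^sup>+x. g ((1 - t) *\<^sub>R x + t *\<^sub>R y) * indicator B y * indicator B x \<partial>lborel) \<partial>lborel)"
      by (rule lborel_pair.Fubini'[symmetric]) measurable
    also have "\<dots> = (\<integral>\<^sup>+y. (\<integral>\<^sup>+x. g ((1 - (1 - t)) *\<^sub>R y + (1 - t) *\<^sub>R x) * indicator B x \<partial>lborel) * indicator B y \<partial>lborel)"
      by (subst nn_integral_multc[symmetric]) (simp_all add: add.commute mult_ac)
    also have "\<dots> \<le> 2 ^ DIM('a) * emeasure lborel B * (\<integral>\<^sup>+x. g x \<partial>lborel)"
      using False by (intro main) simp
    finally show ?thesis .
  qed
qed

section \<open>The Poincare inequality for the oscillation\<close>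

lemma abs_diff_average_on_le:
  fixes u :: "'a::euclidean_space \<Rightarrow> real"
  assumes R: "R > 0" and u: "integrable (lebesgue_on (ball z R)) u"
  shows "ennreal \<bar>u x - average_on (ball z R) u\<bar> \<le>
    ennreal (1 / measure lebesgue (ball z R)) *
    (\<integral>\<^sup>+y. ennreal \<bar>u x - u y\<bar> * indicator (ball z R) y \<partial>lborel)"
proof -
  let ?B = "ball z R" and ?m = "measure lebesgue (ball z R)"
  have m: "?m > 0" using R content_ball_pos by simp
  have fm: "emeasure (lebesgue_on ?B) ?B < \<infinity>"
    using emeasure_lborel_ball_finite[of z R] by (simp add: emeasure_restrict_space)
  have c: "integrable (lebesgue_on ?B) (\<lambda>y. u x)"
    using fm by (intro integrableI_bounded) (auto simp: nn_integral_cmult ennreal_mult_less_top)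
  have "(LINT y|lebesgue_on ?B. u x - u y) = ?m * u x - (LINT y|lebesgue_on ?B. u y)"
    using c u by (simp add: measure_restrict_space)
  then have "u x - average_on ?B u = (1 / ?m) * (LINT y|lebesgue_on ?B. u x - u y)"
    using m by (simp add: average_on_def field_simps)
  then have "ennreal \<bar>u x - average_on ?B u\<bar> = ennreal (1 / ?m) * ennreal \<bar>LINT y|lebesgue_on ?B. u x - u y\<bar>"
    using m by (simp add: abs_mult flip: ennreal_mult)
  also have "\<dots> \<le> ennreal (1 / ?m) * (\<integral>\<^sup>+y. ennreal \<bar>u x - u y\<bar> \<partial>lebesgue_on ?B)"
    using integral_norm_bound_ennreal[OF Bochner_Integration.integrable_diff[OF c u]]
    by (intro mult_left_mono) auto
  also have "(\<integral>\<^sup>+y. ennreal \<bar>u x - u y\<bar> \<partial>lebesgue_on ?B) =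
      (\<integral>\<^sup>+y. ennreal \<bar>u x - u y\<bar> * indicator ?B y \<partial>lborel)"
    by (simp add: nn_integral_restrict_space nn_integral_completion)
  finally show ?thesis .
qed

lemma L1_loc_on_imp_borel_measurable:
  fixes u :: "'a::euclidean_space \<Rightarrow> real"
  assumes "L1_loc_on S u" "open S"
  shows "u \<in> borel_measurable (lebesgue_on S)"
proof -
  obtain K :: "nat \<Rightarrow> 'a set" where K: "\<And>n. compact (K n)" "\<And>n. K n \<subseteq> S" "S = (\<Union>n. K n)"
    using open_Union_compact_subsets[OF assms(2)] by metis
  have um: "u \<in> borel_measurable (lebesgue_on (K n))" for n
    using assms(1) K unfolding L1_loc_on_def L1_on_def by (auto intro: borel_measurable_integrable)
  have piece: "u \<in> borel_measurable (restrict_space (lebesgue_on S) (K n))" for n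
    using K assms(2) um[of n]
    by (subst restrict_restrict_space) (auto simp: Int_absorb1 compact_imp_closed)
  show ?thesis
  proof (rule measurable_piecewise_restrict[where C = "range K"])
    show "Q \<inter> space (lebesgue_on S) \<in> sets (lebesgue_on S)" if "Q \<in> range K" for Q
    proof -
      have "compact Q" using that K(1) by auto
      then have "Q \<in> sets lebesgue" by (simp add: compact_imp_closed)
      then show ?thesis by (auto simp: sets_restrict_space image_iff)
    qed
  qed (use K(3) piece in auto)
qed

text \<open>
  The integrated chain inequality. The bound \<open>2 R \<le> r N\<close> guarantees that \<open>N\<close> steps shorter than
  \<open>r\<close> lead from any point of the open ball to any other.
\<close>

lemma nn_integral_abs_diff_average_le:
  fixes u :: "'a::euclidean_space \<Rightarrow> real"
  assumes R: "R > 0" and r: "r > 0"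
    and u: "integrable (lebesgue_on (ball z R)) u"
    and um: "u \<in> borel_measurable (lebesgue_on (ball z (R + r)))"
    and N: "N > 0" "2 * R \<le> r * real N"
  shows "(\<integral>\<^sup>+x. ennreal \<bar>u x - average_on (ball z R) u\<bar> \<partial>lebesgue_on (ball z R))
    \<le> of_nat N * 2 ^ DIM('a) * (\<integral>\<^sup>+x. e2ennreal (osc_on (ball x r) u) \<partial>lebesgue_on (ball z R))"
proof -
  let ?B = "ball z R" and ?m = "measure lebesgue (ball z R)"
  define g where "g x = e2ennreal (osc_on (ball x r) u) * indicator ?B x" for x
  define p where "p k x y = (1 - real k / real N) *\<^sub>R x + (real k / real N) *\<^sub>R y" for k and x y :: 'a
  have [measurable]: "?B \<in> sets borel" by simp
  have m: "?m > 0" using R content_ball_pos by simp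
  have em: "emeasure lborel ?B = ennreal ?m"
    using emeasure_lborel_ball_finite[of z R] by (simp add: emeasure_eq_ennreal_measure)
  \<comment> \<open>Cutting \<open>g\<close> off outside the ball makes it Borel on the whole space; the chain points stay
    inside by convexity, so nothing is lost.\<close>
  have g[measurable]: "g \<in> borel_measurable borel"
    unfolding g_def
  proof (rule borel_measurable_osc_ball)
    fix x :: 'a assume "x \<in> ?B"
    then have "ball x r \<subseteq> ball z (R + r)"
      by (simp add: ball_subset_ball_iff dist_commute)
    then show "u \<in> borel_measurable (lebesgue_on (ball x r))"
      using um by (rule measurable_restrict_mono[rotated])
  qed simp
  have [measurable]: "(\<lambda>(x,y). p k x y) \<in> borel \<Otimes>\<^sub>M borel \<rightarrow>\<^sub>M borel" for k
    unfolding p_def by measurable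
  obtain G where G: "AE x in lebesgue. x \<in> G"
    and osc: "\<And>a b S. a \<in> G \<Longrightarrow> b \<in> G \<Longrightarrow> open S \<Longrightarrow> a \<in> S \<Longrightarrow> b \<in> S \<Longrightarrow>
      ennreal \<bar>u a - u b\<bar> \<le> e2ennreal (osc_on S u)"
    using AE_abs_diff_le_osc_on[of u] by blast
  have G': "AE x in lborel. x \<in> G" using G by (simp add: AE_completion_iff)
  have chain: "ennreal \<bar>u x - u y\<bar> \<le> (\<Sum>k<N. g (p k x y))"
    if "x \<in> ?B" "y \<in> ?B" and pG: "\<And>k. k \<le> N \<Longrightarrow> p k x y \<in> G" for x y
  proof -
    have step: "ennreal \<bar>u (p k x y) - u (p (Suc k) x y)\<bar> \<le> g (p k x y)" if k: "k < N" for k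
    proof -
      have pB: "p k x y \<in> ?B"
        unfolding p_def using k that \<open>x \<in> ?B\<close> \<open>y \<in> ?B\<close> N
        by (intro convexD[OF convex_ball]) auto
      have "p k x y - p (Suc k) x y = (1 / real N) *\<^sub>R (x - y)"
        unfolding p_def by (simp add: algebra_simps add_divide_distrib)
      then have "dist (p k x y) (p (Suc k) x y) = norm (x - y) / real N"
        by (simp add: dist_norm)
      also have "\<dots> < r"
      proof -
        have "norm (x - y) < 2 * R"
          using dist_triangle3[of x y z] \<open>x \<in> ?B\<close> \<open>y \<in> ?B\<close> by (simp add: dist_norm)
        then show ?thesis using N by (simp add: field_simps)
      qed
      finally show ?thesis
        using osc[of "p k x y" "p (Suc k) x y" "ball (p k x y) r"] pG k r pB
        by (simp add: g_def)
    qed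
    have "u x - u y = (\<Sum>k<N. u (p k x y) - u (p (Suc k) x y))"
      using N sum_lessThan_telescope'[of "\<lambda>k. u (p k x y)" N] by (simp add: p_def)
    then have "\<bar>u x - u y\<bar> \<le> (\<Sum>k<N. \<bar>u (p k x y) - u (p (Suc k) x y)\<bar>)"
      by (metis sum_abs)
    then have "ennreal \<bar>u x - u y\<bar> \<le> (\<Sum>k<N. ennreal \<bar>u (p k x y) - u (p (Suc k) x y)\<bar>)"
      by (simp add: ennreal_leI)
    also have "\<dots> \<le> (\<Sum>k<N. g (p k x y))"
      by (intro sum_mono step) simp
    finally show ?thesis .
  qed
  \<comment> \<open>For fixed \<open>x\<close> and \<open>k > 0\<close> the map \<open>y \<mapsto> p k x y\<close> is a nondegenerate affine map, so it pulls
    null sets back to null sets. For \<open>k = 0\<close> it is constantly \<open>x\<close>, which is why \<open>x\<close> itself has to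
    be a good point.\<close>
  have pG: "AE y in lborel. \<forall>k\<in>{..N}. p k x y \<in> G" if "x \<in> G" for x
  proof (rule AE_ball_countable')
    fix k assume "k \<in> {..N}"
    show "AE y in lborel. p k x y \<in> G"
    proof (cases "k = 0")
      case True
      then show ?thesis using that by (simp add: p_def)
    next
      case False
      then show ?thesis unfolding p_def using N by (intro AE_lborel_affine[OF G']) auto
    qed
  qed simp
  let ?J = "\<lambda>x. \<integral>\<^sup>+y. (\<Sum>k<N. g (p k x y)) * indicator ?B y \<partial>lborel"
  have J: "?J x = (\<Sum>k<N. \<integral>\<^sup>+y. g (p k x y) * indicator ?B y \<partial>lborel)" for x
    unfolding sum_distrib_right by (rule nn_integral_sum) measurable
  have pt: "ennreal \<bar>u x - average_on ?B u\<bar> * indicator ?B x \<le> ennreal (1 / ?m) * (?J x * indicator ?B x)"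
    if "x \<in> G" for x
  proof (cases "x \<in> ?B")
    case True
    have "(\<integral>\<^sup>+y. ennreal \<bar>u x - u y\<bar> * indicator ?B y \<partial>lborel) \<le> ?J x"
    proof (rule nn_integral_mono_AE, use pG[OF that] in \<open>rule eventually_mono\<close>)
      fix y assume "\<forall>k\<in>{..N}. p k x y \<in> G"
      then show "ennreal \<bar>u x - u y\<bar> * indicator ?B y \<le> (\<Sum>k<N. g (p k x y)) * indicator ?B y"
        using chain[OF True, of y] by (auto simp: indicator_def)
    qed
    then show ?thesis
      using order_trans[OF abs_diff_average_on_le[OF R u, of x] mult_left_mono] True by simp
  qed simp
  have "(\<integral>\<^sup>+x. ennreal \<bar>u x - average_on ?B u\<bar> \<partial>lebesgue_on ?B)
      = (\<integral>\<^sup>+x. ennreal \<bar>u x - average_on ?B u\<bar> * indicator ?B x \<partial>lborel)"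
    by (simp add: nn_integral_restrict_space nn_integral_completion)
  also have "\<dots> \<le> (\<integral>\<^sup>+x. ennreal (1 / ?m) * (?J x * indicator ?B x) \<partial>lborel)"
    using G' by (intro nn_integral_mono_AE) (elim eventually_mono, rule pt)
  also have "\<dots> = ennreal (1 / ?m) * (\<integral>\<^sup>+x. ?J x * indicator ?B x \<partial>lborel)"
    by (rule nn_integral_cmult) measurable
  also have "(\<integral>\<^sup>+x. ?J x * indicator ?B x \<partial>lborel) =
      (\<Sum>k<N. \<integral>\<^sup>+x. (\<integral>\<^sup>+y. g (p k x y) * indicator ?B y \<partial>lborel) * indicator ?B x \<partial>lborel)"
    unfolding J unfolding sum_distrib_right by (rule nn_integral_sum) measurable
  also have "\<dots> \<le> (\<Sum>k<N. 2 ^ DIM('a) * emeasure lborel ?B * (\<integral>\<^sup>+x. g x \<partial>lborel))"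
    unfolding p_def by (intro sum_mono nn_integral_segment_point_le) auto
  also have "ennreal (1 / ?m) * \<dots> = (ennreal (1 / ?m) * ennreal ?m) *
      (of_nat N * 2 ^ DIM('a) * (\<integral>\<^sup>+x. g x \<partial>lborel))"
    by (simp add: em mult_ac)
  also have "ennreal (1 / ?m) * ennreal ?m = 1"
    using m by (simp flip: ennreal_mult)
  also have "(\<integral>\<^sup>+x. g x \<partial>lborel) = (\<integral>\<^sup>+x. e2ennreal (osc_on (ball x r) u) \<partial>lebesgue_on ?B)"
    by (simp add: g_def nn_integral_restrict_space nn_integral_completion)
  finally show ?thesis by (simp add: mult_left_mono)
qed

theorem theorem1p16:
  shows "\<exists>C>0. \<forall>(l::real) (R::real) (r::real) (u :: real ^ 'n \<Rightarrow> real).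
    l \<ge> 1 \<longrightarrow> R > 0 \<longrightarrow> r > 0 \<longrightarrow> l * R \<ge> r \<longrightarrow>
    L1_loc_on (ball 0 (R + r)) u \<longrightarrow> Linf_on (ball 0 r) u \<longrightarrow> L1_on (ball 0 R) u \<longrightarrow>
    (\<integral>\<^sup>+x. ennreal \<bar>u x - average_on (ball 0 R) u\<bar> \<partial>lebesgue_on (ball 0 R))
      \<le> ennreal (C * R * l / r) *
        (\<integral>\<^sup>+x. e2ennreal (osc_on (ball x r) u) \<partial>lebesgue_on (ball 0 R))"
proof (intro exI[of _ "3 * 2 ^ DIM(real ^ 'n)"] conjI allI impI)
  fix l R r :: real and u :: "real ^ 'n \<Rightarrow> real"
  assume l: "l \<ge> 1" and R: "R > 0" and r: "r > 0" and lR: "l * R \<ge> r"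
    and loc: "L1_loc_on (ball 0 (R + r)) u" and u: "L1_on (ball 0 R) u"
  let ?I = "\<integral>\<^sup>+x. e2ennreal (osc_on (ball x r) u) \<partial>lebesgue_on (ball 0 R)"
  define N where "N = nat \<lceil>2 * R / r\<rceil>"
  have pos: "2 * R / r > 0" using R r by simp
  then have N: "N > 0" "2 * R / r \<le> real N" "real N \<le> 2 * R / r + 1"
    unfolding N_def by linarith+
  have "2 * R / r + 1 \<le> 3 * (R * l / r)"
  proof -
    have "R * 1 / r \<le> R * l / r"
      using R r l by (intro divide_right_mono mult_left_mono) auto
    moreover have "1 \<le> R * l / r" using lR r by (simp add: mult.commute)
    moreover have "2 * R / r = 2 * (R * 1 / r)" by simp
    ultimately show ?thesis by linarith
  qed
  with N have "real N * 2 ^ DIM(real ^ 'n) \<le> 3 * (R * l / r) * 2 ^ DIM(real ^ 'n)"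
    by (intro mult_right_mono) auto
  then have NC: "real N * 2 ^ DIM(real ^ 'n) \<le> 3 * 2 ^ DIM(real ^ 'n) * R * l / r"
    by (simp add: mult_ac)
  have "(\<integral>\<^sup>+x. ennreal \<bar>u x - average_on (ball 0 R) u\<bar> \<partial>lebesgue_on (ball 0 R))
      \<le> of_nat N * 2 ^ DIM(real ^ 'n) * ?I"
    using R r u N L1_loc_on_imp_borel_measurable[OF loc]
    by (intro nn_integral_abs_diff_average_le) (auto simp: L1_on_def field_simps)
  also have "of_nat N * 2 ^ DIM(real ^ 'n) = ennreal (real N * 2 ^ DIM(real ^ 'n))"
    by (simp add: ennreal_mult ennreal_of_nat_eq_real_of_nat flip: ennreal_power)
  also have "\<dots> * ?I \<le> ennreal (3 * 2 ^ DIM(real ^ 'n) * R * l / r) * ?I"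
    using NC by (intro mult_right_mono ennreal_leI) auto
  finally show "(\<integral>\<^sup>+x. ennreal \<bar>u x - average_on (ball 0 R) u\<bar> \<partial>lebesgue_on (ball 0 R))
      \<le> ennreal (3 * 2 ^ DIM(real ^ 'n) * R * l / r) * ?I" .
qed simp

end
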